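(* Let $M = E;S\rhd P$ be a (well-formed) cyber-physical system of the calculus described in the context. Then: (a) (time determinism) if $M \xrightarrow{\mathsf{tick}} \gamma$ and $M\xrightarrow{\mathsf{tick}} \gamma'$ then $\gamma\equiv\gamma'$; (b) (maximal progress) if $M\xrightarrow{\tau}\gamma$ then there is no $\gamma'$ with $M\xrightarrow{\mathsf{tick}}\gamma'$; (c) (patience) if there is no $\gamma$ with $M\xrightarrow{\mathsf{tick}}\gamma$, then either $S$ does not satisfy the invariant of $E$ (i.e. $S\notin \mathit{inv}$) or there is $\gamma'$ with $M\xrightarrow{\tau}\gamma'$; (d) (well-timedness) there is $k\in\mathbb N$ such that whenever $M\xrightarrow{\alpha_1}\cdots\xrightarrow{\alpha_n}N$ is a computation trace with $\alpha_i\neq\mathsf{tick}$ for all $i$, then $n\le k$.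
   Context: The calculus. Fix pairwise disjoint sets of state variables $\mathsf X$, sensors $\mathsf S$, actuators $\mathsf A$ and communication channels; values $v$ include reals, Booleans and names. For a set $\mathsf N$, $\mathbb R^{\mathsf N}$ is the set of functions $\mathsf N\to\mathbb R$ and $\xi[n\mapsto v]$ denotes function update. $\mathcal D(O)$ is the set of finite-support probability distributions on $O$, $\overline{o}$ is the Dirac distribution at $o$, and $\sum_i p_i\cdot\gamma_i$ is the pointwise convex combination. A physical state is $S=\langle\xi_x,\xi_s,\xi_a\rangle$ with $\xi_x\in\mathbb R^{\mathsf X}$, $\xi_s\in\mathbb R^{\mathsf S}$, $\xi_a\in\mathbb R^{\mathsf A}$ (total). A physical environment is $E=\langle \mathit{evol},\mathit{meas},\mathit{inv}\rangle$ with total maps $\mathit{evol}:\mathbb R^{\mathsf X}\times\mathbb R^{\mathsf A}\to\mathcal D(\mathbb R^{\mathsf X})$, $\mathit{meas}:\mathbb R^{\mathsf X}\to\mathcal D(\mathbb R^{\mathsf S})$ and $\mathit{inv}\subseteq\mathbb R^{\mathsf X}$; $S\in\mathit{inv}$ means $\xi_x\in\mathit{inv}$. Define $\mathit{next}_E(S)=\sum_{\xi'_x\in\mathrm{supp}(\mathit{evol}(\xi_x,\xi_a)),\ \xi'_s\in\mathrm{supp}(\mathit{meas}(\xi'_x))}\mathit{evol}(\xi_x,\xi_a)(\xi'_x)\cdot\mathit{meas}(\xi'_x)(\xi'_s)\cdot\overline{\langle\xi'_x,\xi'_s,\xi_a\rangle}$. Processes: $P,Q::=\mathsf{nil}\mid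 \mathsf{tick}.C\mid P\parallel Q\mid \lfloor \mathit{chn}.C\rfloor D\mid \mathit{phy}.C\mid \mathsf{if}\ b\ \mathsf{then}\ P\ \mathsf{else}\ Q\mid P\backslash c\mid X\mid \mathsf{fix}\,X.P$; $C,D::=\bigoplus_{i\in I}p_i{:}P_i$ ($I$ finite nonempty, $p_i\in(0,1]$, $\sum p_i=1$); $\mathit{chn}::= c!v\mid c?(x)$; $\mathit{phy}::=\mathsf{read}\ s(x)\mid \mathsf{write}\ a\langle v\rangle$. In $\mathsf{fix}\,X.P$ every occurrence of $X$ in $P$ is time-guarded (occurs inside a $D$ of $\mathsf{tick}.D$ or $\lfloor\mathit{chn}.C\rfloor D$). Processes are closed; a conditional is identified with the branch selected by its decidable guard $b$. $[\![\bigoplus_i p_i{:}P_i]\!]=\sum_ip_i\cdot\overline{P_i}$; $(\pi_1\parallel\pi_2)(P_1\parallel P_2)=\pi_1(P_1)\pi_2(P_2)$ (and $0$ on processes not of that form); $\pi\backslash c$ and $\pi\{v/x\}$ apply the operation to each process of the support. Process transitions $P\xrightarrow{\lambda}\pi$, $\lambda\in\{\mathsf{tick},\tau,c!v,c?v,a!v,s?x\}$: $\lfloor c!v.C\rfloor D\xrightarrow{c!v}[\![C]\!]$; $\lfloor c?(x).C\rfloor D\xrightarrow{c?v}[\![C]\!]\{v/x\}$; $\mathsf{write}\ a\langle v\rangle.C\xrightarrow{a!v}[\![C]\!]$; $\mathsf{read}\ s(x).C\xrightarrow{s?x}[\![C]\!]$; if $P_1\xrightarrow{c!v}\pi_1$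 and $P_2\xrightarrow{c?v}\pi_2$ then $P_1\parallel P_2\xrightarrow{\tau}\pi_1\parallel\pi_2$ (and symmetrically); if $P\xrightarrow{\lambda}\pi$ with $\lambda\neq\mathsf{tick}$ then $P\parallel Q\xrightarrow{\lambda}\pi\parallel\overline{Q}$ (and symmetrically); if $P\xrightarrow{\lambda}\pi$ with $\lambda\notin\{c?v,c!v\}$ then $P\backslash c\xrightarrow{\lambda}\pi\backslash c$; if $P\{\mathsf{fix}\,X.P/X\}\xrightarrow{\lambda}\pi$ then $\mathsf{fix}\,X.P\xrightarrow{\lambda}\pi$; $\mathsf{nil}\xrightarrow{\mathsf{tick}}\overline{\mathsf{nil}}$; $\mathsf{tick}.C\xrightarrow{\mathsf{tick}}[\![C]\!]$; $\lfloor\mathit{chn}.C\rfloor D\xrightarrow{\mathsf{tick}}[\![D]\!]$; if $P_1\xrightarrow{\mathsf{tick}}\pi_1$, $P_2\xrightarrow{\mathsf{tick}}\pi_2$ and $P_1\parallel P_2$ has no $\tau$-transition, then $P_1\parallel P_2\xrightarrow{\mathsf{tick}}\pi_1\parallel\pi_2$. Cyber-physical systems (CPSs) are $E;S\rhd P$, well-formed (every sensor/actuator in $P$ is in the domain of $\xi_s$/$\xi_a$); there is also a special CPS $\mathsf{Dead}$ with no transitions. For distributions $\sigma$ over physical states and $\pi$ over processes, $E;\sigma\rhd\pi$ is the distribution giving $E;S\rhd P$ mass $\sigma(S)\pi(P)$. CPS transitions, with actions $\alpha\in\{\tau,c!v,c?v,\mathsf{tick}\}$ and $E=\langle\mathit{evol},\mathit{meas},\mathit{inv}\rangle$,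 $S=\langle\xi_x,\xi_s,\xi_a\rangle$: if $P\xrightarrow{\alpha}\pi$ with $\alpha\in\{c!v,c?v,\tau\}$ and $S\in\mathit{inv}$ then $E;S\rhd P\xrightarrow{\alpha}E;\overline S\rhd\pi$; if $P\xrightarrow{s?z}\pi$, $\xi_s(s)=\sum_i p_i\cdot\overline{v_i}$ (for a real value, the Dirac distribution) and $S\in\mathit{inv}$ then $E;S\rhd P\xrightarrow{\tau}E;\overline S\rhd\sum_ip_i\cdot\pi\{v_i/z\}$; if $P\xrightarrow{a!v}\pi$ and $S\in\mathit{inv}$ then $E;S\rhd P\xrightarrow{\tau}E;\overline{\langle\xi_x,\xi_s,\xi_a[a\mapsto v]\rangle}\rhd\pi$; if $P\xrightarrow{\mathsf{tick}}\pi$, $E;S\rhd P$ has no $\tau$-transition and $S\in\mathit{inv}$ then $E;S\rhd P\xrightarrow{\mathsf{tick}}E;\mathit{next}_E(S)\rhd\pi$; if $S\notin\mathit{inv}$ then $E;S\rhd P\xrightarrow{\tau}\overline{\mathsf{Dead}}$. A computation trace $M_1\xrightarrow{\alpha_1}M_2\cdots\xrightarrow{\alpha_{n-1}}M_n$ means $M_i\xrightarrow{\alpha_i}\gamma_{i+1}$ with $M_{i+1}\in\mathrm{supp}(\gamma_{i+1})$. $\equiv$ is the standard structural congruence of timed processes (parallel composition associative and commutative with unit $\mathsf{nil}$, unfolding of recursion, etc.), lifted to CPSs by $E;S\rhd P\equiv E;S\rhd Q$ iff $P\equiv Q$, and to distributions by $\gamma\equiv\gamma'$ iff they assign the same mass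 to every $\equiv$-class. *)

theory Defs
  imports "HOL-Probability.Probability"
begin

section \<open>Syntax\<close>

text \<open>
  The pairwise disjoint sets of state variables, sensors, actuators and channels are the
  type variables \<open>'x\<close>, \<open>'s\<close>, \<open>'a\<close> and \<open>'c\<close>.
\<close>

datatype ('x, 's, 'a, 'c) val =
  RealV real
| BoolV bool
| StateName 'x
| SensorName 's
| ActuatorName 'a
| ChannelName 'c

type_synonym vname = string
type_synonym pname = string

text \<open>An output \<open>c!v\<close> or \<open>write a\<langle>v\<rangle>\<close> under a binder may mention a bound variable in place of \<open>v\<close>.\<close>

datatype ('x, 's, 'a, 'c) exp = Val "('x, 's, 'a, 'c) val" | Var vname

datatype ('x, 's, 'a, 'c) chn = Snd 'c "('x, 's, 'a, 'c) exp" | Rcv 'c vname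

datatype ('x, 's, 'a, 'c) phy = Read 's vname | Write 'a "('x, 's, 'a, 'c) exp"

text \<open>
  A probabilistic choice \<open>\<Oplus>\<^sub>i p\<^sub>i : P\<^sub>i\<close> is a list of pairs \<open>(P\<^sub>i, p\<^sub>i)\<close>. \<open>Timeout chn C D\<close> is
  \<open>\<lfloor>chn.C\<rfloor>D\<close>. The guard of a conditional is an arbitrary predicate on finitely many data;
  it has a truth value as soon as all of them are values.
\<close>

datatype ('x, 's, 'a, 'c) proc =
  Stop
| Tick "(('x, 's, 'a, 'c) proc \<times> real) list"
| Par "('x, 's, 'a, 'c) proc" "('x, 's, 'a, 'c) proc"
| Timeout "('x, 's, 'a, 'c) chn"
    "(('x, 's, 'a, 'c) proc \<times> real) list" "(('x, 's, 'a, 'c) proc \<times> real) list"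
| Phy "('x, 's, 'a, 'c) phy" "(('x, 's, 'a, 'c) proc \<times> real) list"
| Cond "('x, 's, 'a, 'c) val list \<Rightarrow> bool" "('x, 's, 'a, 'c) exp list"
    "('x, 's, 'a, 'c) proc" "('x, 's, 'a, 'c) proc"
| Res "('x, 's, 'a, 'c) proc" 'c
| PVar pname
| Fix pname "('x, 's, 'a, 'c) proc"

type_synonym ('x, 's, 'a, 'c) choice = "(('x, 's, 'a, 'c) proc \<times> real) list"

lemma size_choice [termination_simp]:
  "(P, p) \<in> set C \<Longrightarrow> size P < Suc (size_list (size_prod size (\<lambda>_. 0)) C)"
  by (induction C) auto

section \<open>Variables and substitution\<close>

fun exp_vars :: "('x, 's, 'a, 'c) exp \<Rightarrow> vname set" where
  "exp_vars (Val v) = {}"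
| "exp_vars (Var x) = {x}"

fun chn_free :: "('x, 's, 'a, 'c) chn \<Rightarrow> vname set" where
  "chn_free (Snd c e) = exp_vars e"
| "chn_free (Rcv c x) = {}"

fun chn_bound :: "('x, 's, 'a, 'c) chn \<Rightarrow> vname set" where
  "chn_bound (Snd c e) = {}"
| "chn_bound (Rcv c x) = {x}"

fun phy_free :: "('x, 's, 'a, 'c) phy \<Rightarrow> vname set" where
  "phy_free (Read s x) = {}"
| "phy_free (Write a e) = exp_vars e"

fun phy_bound :: "('x, 's, 'a, 'c) phy \<Rightarrow> vname set" where
  "phy_bound (Read s x) = {x}"
| "phy_bound (Write a e) = {}"

text \<open>The variable bound by \<open>c?(x)\<close> in \<open>\<lfloor>c?(x).C\<rfloor>D\<close> has scope \<open>C\<close> only.\<close>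

fun fv :: "('x, 's, 'a, 'c) proc \<Rightarrow> vname set" where
  "fv Stop = {}"
| "fv (Tick C) = (\<Union>(P, p)\<in>set C. fv P)"
| "fv (Par P Q) = fv P \<union> fv Q"
| "fv (Timeout ch C D) =
     chn_free ch \<union> ((\<Union>(P, p)\<in>set C. fv P) - chn_bound ch) \<union> (\<Union>(P, p)\<in>set D. fv P)"
| "fv (Phy ph C) = phy_free ph \<union> ((\<Union>(P, p)\<in>set C. fv P) - phy_bound ph)"
| "fv (Cond b es P Q) = (\<Union>e\<in>set es. exp_vars e) \<union> fv P \<union> fv Q"
| "fv (Res P c) = fv P"
| "fv (PVar X) = {}"
| "fv (Fix X P) = fv P"

fun bv :: "('x, 's, 'a, 'c) proc \<Rightarrow> vname set" where
  "bv Stop = {}"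
| "bv (Tick C) = (\<Union>(P, p)\<in>set C. bv P)"
| "bv (Par P Q) = bv P \<union> bv Q"
| "bv (Timeout ch C D) =
     chn_bound ch \<union> (\<Union>(P, p)\<in>set C. bv P) \<union> (\<Union>(P, p)\<in>set D. bv P)"
| "bv (Phy ph C) = phy_bound ph \<union> (\<Union>(P, p)\<in>set C. bv P)"
| "bv (Cond b es P Q) = bv P \<union> bv Q"
| "bv (Res P c) = bv P"
| "bv (PVar X) = {}"
| "bv (Fix X P) = bv P"

fun fpv :: "('x, 's, 'a, 'c) proc \<Rightarrow> pname set" where
  "fpv Stop = {}"
| "fpv (Tick C) = (\<Union>(P, p)\<in>set C. fpv P)"
| "fpv (Par P Q) = fpv P \<union> fpv Q"
| "fpv (Timeout ch C D) = (\<Union>(P, p)\<in>set C. fpv P) \<union> (\<Union>(P, p)\<in>set D. fpv P)"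
| "fpv (Phy ph C) = (\<Union>(P, p)\<in>set C. fpv P)"
| "fpv (Cond b es P Q) = fpv P \<union> fpv Q"
| "fpv (Res P c) = fpv P"
| "fpv (PVar X) = {X}"
| "fpv (Fix X P) = fpv P - {X}"

fun bpv :: "('x, 's, 'a, 'c) proc \<Rightarrow> pname set" where
  "bpv Stop = {}"
| "bpv (Tick C) = (\<Union>(P, p)\<in>set C. bpv P)"
| "bpv (Par P Q) = bpv P \<union> bpv Q"
| "bpv (Timeout ch C D) = (\<Union>(P, p)\<in>set C. bpv P) \<union> (\<Union>(P, p)\<in>set D. bpv P)"
| "bpv (Phy ph C) = (\<Union>(P, p)\<in>set C. bpv P)"
| "bpv (Cond b es P Q) = bpv P \<union> bpv Q"
| "bpv (Res P c) = bpv P"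
| "bpv (PVar X) = {}"
| "bpv (Fix X P) = insert X (bpv P)"

text \<open>
  Channels are never substituted, so only occurrences in prefixes count as uses of a channel;
  a channel name transmitted as a value is plain data.
\<close>

fun chn_channel :: "('x, 's, 'a, 'c) chn \<Rightarrow> 'c" where
  "chn_channel (Snd c e) = c"
| "chn_channel (Rcv c x) = c"

fun fchans :: "('x, 's, 'a, 'c) proc \<Rightarrow> 'c set" where
  "fchans Stop = {}"
| "fchans (Tick C) = (\<Union>(P, p)\<in>set C. fchans P)"
| "fchans (Par P Q) = fchans P \<union> fchans Q"
| "fchans (Timeout ch C D) =
     insert (chn_channel ch) ((\<Union>(P, p)\<in>set C. fchans P) \<union> (\<Union>(P, p)\<in>set D. fchans P))"
| "fchans (Phy ph C) = (\<Union>(P, p)\<in>set C. fchans P)"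
| "fchans (Cond b es P Q) = fchans P \<union> fchans Q"
| "fchans (Res P c) = fchans P - {c}"
| "fchans (PVar X) = {}"
| "fchans (Fix X P) = fchans P"

text \<open>
  Both substitutions below are textual except that they stop at a rebinding of the substituted
  variable. No capture can occur when the substituted object is closed, as it always is in the
  transition rules for closed processes; the structural congruence, which also relates open
  processes, has explicit side conditions.
\<close>

fun subst_exp :: "vname \<Rightarrow> ('x, 's, 'a, 'c) exp \<Rightarrow> ('x, 's, 'a, 'c) exp \<Rightarrow> ('x, 's, 'a, 'c) exp" where
  "subst_exp z u (Val v) = Val v"
| "subst_exp z u (Var x) = (if x = z then u else Var x)"

fun subst_chn :: "vname \<Rightarrow> ('x, 's, 'a, 'c) exp \<Rightarrow> ('x, 's, 'a, 'c) chn \<Rightarrow> ('x, 's, 'a, 'c) chn" where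
  "subst_chn z u (Snd c e) = Snd c (subst_exp z u e)"
| "subst_chn z u (Rcv c x) = Rcv c x"

fun subst_phy :: "vname \<Rightarrow> ('x, 's, 'a, 'c) exp \<Rightarrow> ('x, 's, 'a, 'c) phy \<Rightarrow> ('x, 's, 'a, 'c) phy" where
  "subst_phy z u (Read s x) = Read s x"
| "subst_phy z u (Write a e) = Write a (subst_exp z u e)"

fun subst :: "vname \<Rightarrow> ('x, 's, 'a, 'c) exp \<Rightarrow> ('x, 's, 'a, 'c) proc \<Rightarrow> ('x, 's, 'a, 'c) proc" where
  "subst z u Stop = Stop"
| "subst z u (Tick C) = Tick (map (\<lambda>(P, p). (subst z u P, p)) C)"
| "subst z u (Par P Q) = Par (subst z u P) (subst z u Q)"
| "subst z u (Timeout ch C D) =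
     Timeout (subst_chn z u ch)
       (if z \<in> chn_bound ch then C else map (\<lambda>(P, p). (subst z u P, p)) C)
       (map (\<lambda>(P, p). (subst z u P, p)) D)"
| "subst z u (Phy ph C) =
     Phy (subst_phy z u ph)
       (if z \<in> phy_bound ph then C else map (\<lambda>(P, p). (subst z u P, p)) C)"
| "subst z u (Cond b es P Q) = Cond b (map (subst_exp z u) es) (subst z u P) (subst z u Q)"
| "subst z u (Res P c) = Res (subst z u P) c"
| "subst z u (PVar X) = PVar X"
| "subst z u (Fix X P) = Fix X (subst z u P)"

fun psubst :: "pname \<Rightarrow> ('x, 's, 'a, 'c) proc \<Rightarrow> ('x, 's, 'a, 'c) proc \<Rightarrow> ('x, 's, 'a, 'c) proc" where
  "psubst X R Stop = Stop"
| "psubst X R (Tick C) = Tick (map (\<lambda>(P, p). (psubst X R P, p)) C)"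
| "psubst X R (Par P Q) = Par (psubst X R P) (psubst X R Q)"
| "psubst X R (Timeout ch C D) =
     Timeout ch (map (\<lambda>(P, p). (psubst X R P, p)) C) (map (\<lambda>(P, p). (psubst X R P, p)) D)"
| "psubst X R (Phy ph C) = Phy ph (map (\<lambda>(P, p). (psubst X R P, p)) C)"
| "psubst X R (Cond b es P Q) = Cond b es (psubst X R P) (psubst X R Q)"
| "psubst X R (Res P c) = Res (psubst X R P) c"
| "psubst X R (PVar Y) = (if Y = X then R else PVar Y)"
| "psubst X R (Fix Y P) = (if Y = X then Fix Y P else Fix Y (psubst X R P))"

section \<open>Well-formed processes\<close>

text \<open>
  \<open>time_guarded X P\<close>: every free occurrence of \<open>X\<close> in \<open>P\<close> lies inside a \<open>D\<close> of some \<open>tick.D\<close> or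
  \<open>\<lfloor>chn.C\<rfloor>D\<close>. Those \<open>D\<close> are therefore not inspected.
\<close>

fun time_guarded :: "pname \<Rightarrow> ('x, 's, 'a, 'c) proc \<Rightarrow> bool" where
  "time_guarded X Stop \<longleftrightarrow> True"
| "time_guarded X (Tick D) \<longleftrightarrow> True"
| "time_guarded X (Par P Q) \<longleftrightarrow> time_guarded X P \<and> time_guarded X Q"
| "time_guarded X (Timeout ch C D) \<longleftrightarrow> (\<forall>(P, p)\<in>set C. time_guarded X P)"
| "time_guarded X (Phy ph C) \<longleftrightarrow> (\<forall>(P, p)\<in>set C. time_guarded X P)"
| "time_guarded X (Cond b es P Q) \<longleftrightarrow> time_guarded X P \<and> time_guarded X Q"
| "time_guarded X (Res P c) \<longleftrightarrow> time_guarded X P"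
| "time_guarded X (PVar Y) \<longleftrightarrow> Y \<noteq> X"
| "time_guarded X (Fix Y P) \<longleftrightarrow> Y = X \<or> time_guarded X P"

text \<open>Nonemptiness of the index set follows from the probabilities summing to 1.\<close>

definition wf_weights :: "('x, 's, 'a, 'c) choice \<Rightarrow> bool" where
  "wf_weights C \<longleftrightarrow> (\<forall>(P, p)\<in>set C. 0 < p \<and> p \<le> 1) \<and> (\<Sum>(P, p)\<leftarrow>C. p) = 1"

text \<open>
  Actuators hold reals, so a value written to one has to be a real for the updated actuator state
  \<open>\<xi>\<^sub>a[a \<mapsto> v]\<close> to be defined.
\<close>

fun wf_phy :: "('x, 's, 'a, 'c) phy \<Rightarrow> bool" where
  "wf_phy (Read s x) \<longleftrightarrow> True"
| "wf_phy (Write a (Val v)) \<longleftrightarrow> (\<exists>r. v = RealV r)"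
| "wf_phy (Write a (Var x)) \<longleftrightarrow> True"

fun wf_proc :: "('x, 's, 'a, 'c) proc \<Rightarrow> bool" where
  "wf_proc Stop \<longleftrightarrow> True"
| "wf_proc (Tick C) \<longleftrightarrow> wf_weights C \<and> (\<forall>(P, p)\<in>set C. wf_proc P)"
| "wf_proc (Par P Q) \<longleftrightarrow> wf_proc P \<and> wf_proc Q"
| "wf_proc (Timeout ch C D) \<longleftrightarrow>
     wf_weights C \<and> (\<forall>(P, p)\<in>set C. wf_proc P) \<and> wf_weights D \<and> (\<forall>(P, p)\<in>set D. wf_proc P)"
| "wf_proc (Phy ph C) \<longleftrightarrow> wf_phy ph \<and> wf_weights C \<and> (\<forall>(P, p)\<in>set C. wf_proc P)"
| "wf_proc (Cond b es P Q) \<longleftrightarrow> wf_proc P \<and> wf_proc Q"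
| "wf_proc (Res P c) \<longleftrightarrow> wf_proc P"
| "wf_proc (PVar X) \<longleftrightarrow> True"
| "wf_proc (Fix X P) \<longleftrightarrow> time_guarded X P \<and> wf_proc P"

definition closed_proc :: "('x, 's, 'a, 'c) proc \<Rightarrow> bool" where
  "closed_proc P \<longleftrightarrow> fv P = {} \<and> fpv P = {}"

section \<open>Process transitions\<close>

text \<open>
  The same labels serve for processes and for cyber-physical systems; the latter only ever
  use \<open>TauL\<close>, \<open>OutL\<close>, \<open>InL\<close> and \<open>TickL\<close>.
\<close>

datatype ('x, 's, 'a, 'c) label =
  TickL
| TauL
| OutL 'c "('x, 's, 'a, 'c) val"
| InL 'c "('x, 's, 'a, 'c) val"
| WriteL 'a "('x, 's, 'a, 'c) val"
| ReadL 's vname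

definition choice_dist :: "('x, 's, 'a, 'c) choice \<Rightarrow> ('x, 's, 'a, 'c) proc pmf" where
  "choice_dist C = pmf_of_list C"

definition par_dist ::
  "('x, 's, 'a, 'c) proc pmf \<Rightarrow> ('x, 's, 'a, 'c) proc pmf \<Rightarrow> ('x, 's, 'a, 'c) proc pmf" where
  "par_dist \<pi>1 \<pi>2 = map_pmf (\<lambda>(P, Q). Par P Q) (pair_pmf \<pi>1 \<pi>2)"

text \<open>
  The rule for \<open>tick\<close> of a parallel composition has a negative premise on \<open>\<tau>\<close>-transitions. As
  these never depend on \<open>tick\<close>-transitions, the relation is defined in two strata.
  No rule of \<open>untimed\<close> yields the label \<open>TickL\<close>, so \<open>Par1\<close> and \<open>Par2\<close> need no side condition
  excluding it.
  A conditional with a decided guard has exactly the transitions of the selected branch.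
\<close>

inductive untimed ::
  "('x, 's, 'a, 'c) proc \<Rightarrow> ('x, 's, 'a, 'c) label \<Rightarrow> ('x, 's, 'a, 'c) proc pmf \<Rightarrow> bool"
where
  Out: "untimed (Timeout (Snd c (Val v)) C D) (OutL c v) (choice_dist C)"
| Inp: "untimed (Timeout (Rcv c x) C D) (InL c v) (map_pmf (subst x (Val v)) (choice_dist C))"
| Write: "untimed (Phy (Write a (Val v)) C) (WriteL a v) (choice_dist C)"
| Read: "untimed (Phy (Read s x) C) (ReadL s x) (choice_dist C)"
| Com1: "untimed P (OutL c v) \<pi>1 \<Longrightarrow> untimed Q (InL c v) \<pi>2 \<Longrightarrow>
    untimed (Par P Q) TauL (par_dist \<pi>1 \<pi>2)"
| Com2: "untimed P (InL c v) \<pi>1 \<Longrightarrow> untimed Q (OutL c v) \<pi>2 \<Longrightarrow>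
    untimed (Par P Q) TauL (par_dist \<pi>1 \<pi>2)"
| Par1: "untimed P l \<pi> \<Longrightarrow> untimed (Par P Q) l (par_dist \<pi> (return_pmf Q))"
| Par2: "untimed Q l \<pi> \<Longrightarrow> untimed (Par P Q) l (par_dist (return_pmf P) \<pi>)"
| Res: "untimed P l \<pi> \<Longrightarrow> (\<And>v. l \<noteq> InL c v \<and> l \<noteq> OutL c v) \<Longrightarrow>
    untimed (Res P c) l (map_pmf (\<lambda>R. Res R c) \<pi>)"
| Cond: "es = map Val vs \<Longrightarrow> untimed (if b vs then P else Q) l \<pi> \<Longrightarrow>
    untimed (Cond b es P Q) l \<pi>"
| Fix: "untimed (psubst X (Fix X P) P) l \<pi> \<Longrightarrow> untimed (Fix X P) l \<pi>"

inductive proc_trans ::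
  "('x, 's, 'a, 'c) proc \<Rightarrow> ('x, 's, 'a, 'c) label \<Rightarrow> ('x, 's, 'a, 'c) proc pmf \<Rightarrow> bool"
where
  Untimed: "untimed P l \<pi> \<Longrightarrow> proc_trans P l \<pi>"
| TimeNil: "proc_trans Stop TickL (return_pmf Stop)"
| Delay: "proc_trans (Tick C) TickL (choice_dist C)"
| TimeoutTick: "proc_trans (Timeout ch C D) TickL (choice_dist D)"
| ParTick: "proc_trans P TickL \<pi>1 \<Longrightarrow> proc_trans Q TickL \<pi>2 \<Longrightarrow>
    \<not> (\<exists>\<pi>. untimed (Par P Q) TauL \<pi>) \<Longrightarrow>
    proc_trans (Par P Q) TickL (par_dist \<pi>1 \<pi>2)"
| ResTick: "proc_trans P TickL \<pi> \<Longrightarrow> proc_trans (Res P c) TickL (map_pmf (\<lambda>R. Res R c) \<pi>)"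
| CondTick: "es = map Val vs \<Longrightarrow> proc_trans (if b vs then P else Q) TickL \<pi> \<Longrightarrow>
    proc_trans (Cond b es P Q) TickL \<pi>"
| FixTick: "proc_trans (psubst X (Fix X P) P) TickL \<pi> \<Longrightarrow> proc_trans (Fix X P) TickL \<pi>"

section \<open>Cyber-physical systems\<close>

record ('x, 's, 'a) state =
  xi_x :: "'x \<Rightarrow> real"
  xi_s :: "'s \<Rightarrow> real"
  xi_a :: "'a \<Rightarrow> real"

record ('x, 's, 'a) env =
  evol :: "('x \<Rightarrow> real) \<times> ('a \<Rightarrow> real) \<Rightarrow> ('x \<Rightarrow> real) pmf"
  meas :: "('x \<Rightarrow> real) \<Rightarrow> ('s \<Rightarrow> real) pmf"
  invar :: "('x \<Rightarrow> real) set"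

definition wf_env :: "('x, 's, 'a) env \<Rightarrow> bool" where
  "wf_env E \<longleftrightarrow>
    (\<forall>x a. finite (set_pmf (evol E (x, a)))) \<and> (\<forall>x. finite (set_pmf (meas E x)))"

definition sat_inv :: "('x, 's, 'a) env \<Rightarrow> ('x, 's, 'a) state \<Rightarrow> bool" where
  "sat_inv E S \<longleftrightarrow> xi_x S \<in> invar E"

definition next_state :: "('x, 's, 'a) env \<Rightarrow> ('x, 's, 'a) state \<Rightarrow> ('x, 's, 'a) state pmf" where
  "next_state E S =
    bind_pmf (evol E (xi_x S, xi_a S)) (\<lambda>x'.
    bind_pmf (meas E x') (\<lambda>s'.
    return_pmf \<lparr>xi_x = x', xi_s = s', xi_a = xi_a S\<rparr>))"

datatype ('x, 's, 'a, 'c) cps =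
  CPS "('x, 's, 'a) env" "('x, 's, 'a) state" "('x, 's, 'a, 'c) proc"
| Dead

text \<open>
  Sensor and actuator states are total on the types \<open>'s\<close> and \<open>'a\<close> from which all sensors and
  actuators of \<open>P\<close> are drawn, so that these automatically lie in their domains.
\<close>

fun wf_cps :: "('x, 's, 'a, 'c) cps \<Rightarrow> bool" where
  "wf_cps (CPS E S P) \<longleftrightarrow> wf_env E \<and> wf_proc P \<and> closed_proc P"
| "wf_cps Dead \<longleftrightarrow> True"

definition cps_dist ::
  "('x, 's, 'a) env \<Rightarrow> ('x, 's, 'a) state pmf \<Rightarrow> ('x, 's, 'a, 'c) proc pmf \<Rightarrow>
    ('x, 's, 'a, 'c) cps pmf" where
  "cps_dist E \<sigma> \<pi> = map_pmf (\<lambda>(S, P). CPS E S P) (pair_pmf \<sigma> \<pi>)"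

text \<open>
  In \<open>SensRead\<close> the value held by the sensor is real, hence its distribution is Dirac.
  The transitions other than \<open>tick\<close> again form a stratum of their own.
\<close>

inductive cps_untimed ::
  "('x, 's, 'a, 'c) cps \<Rightarrow> ('x, 's, 'a, 'c) label \<Rightarrow> ('x, 's, 'a, 'c) cps pmf \<Rightarrow> bool"
where
  Out: "proc_trans P (OutL c v) \<pi> \<Longrightarrow> sat_inv E S \<Longrightarrow>
    cps_untimed (CPS E S P) (OutL c v) (cps_dist E (return_pmf S) \<pi>)"
| Inp: "proc_trans P (InL c v) \<pi> \<Longrightarrow> sat_inv E S \<Longrightarrow>
    cps_untimed (CPS E S P) (InL c v) (cps_dist E (return_pmf S) \<pi>)"
| Tau: "proc_trans P TauL \<pi> \<Longrightarrow> sat_inv E S \<Longrightarrow>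
    cps_untimed (CPS E S P) TauL (cps_dist E (return_pmf S) \<pi>)"
| SensRead: "proc_trans P (ReadL s z) \<pi> \<Longrightarrow> sat_inv E S \<Longrightarrow>
    cps_untimed (CPS E S P) TauL
      (cps_dist E (return_pmf S) (map_pmf (subst z (Val (RealV (xi_s S s)))) \<pi>))"
| ActWrite: "proc_trans P (WriteL a (RealV r)) \<pi> \<Longrightarrow> sat_inv E S \<Longrightarrow>
    cps_untimed (CPS E S P) TauL
      (cps_dist E (return_pmf (S\<lparr>xi_a := (xi_a S)(a := r)\<rparr>)) \<pi>)"
| Deadlock: "\<not> sat_inv E S \<Longrightarrow> cps_untimed (CPS E S P) TauL (return_pmf Dead)"

inductive cps_trans ::
  "('x, 's, 'a, 'c) cps \<Rightarrow> ('x, 's, 'a, 'c) label \<Rightarrow> ('x, 's, 'a, 'c) cps pmf \<Rightarrow> bool"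
where
  Untimed: "cps_untimed M l \<gamma> \<Longrightarrow> cps_trans M l \<gamma>"
| Time: "proc_trans P TickL \<pi> \<Longrightarrow> \<not> (\<exists>\<gamma>. cps_untimed (CPS E S P) TauL \<gamma>) \<Longrightarrow> sat_inv E S \<Longrightarrow>
    cps_trans (CPS E S P) TickL (cps_dist E (next_state E S) \<pi>)"

inductive cps_trace ::
  "('x, 's, 'a, 'c) cps \<Rightarrow> ('x, 's, 'a, 'c) label list \<Rightarrow> ('x, 's, 'a, 'c) cps \<Rightarrow> bool"
where
  Empty: "cps_trace M [] M"
| Step: "cps_trans M l \<gamma> \<Longrightarrow> M' \<in> set_pmf \<gamma> \<Longrightarrow> cps_trace M' ls N \<Longrightarrow> cps_trace M (l # ls) N"

section \<open>Structural congruence\<close>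

text \<open>
  The least congruence containing the commutative monoid laws of parallel composition, unfolding
  of recursion, the identification of a conditional with its selected branch, the scope laws of
  restriction, renaming of bound variables, and reordering of the summands of a probabilistic
  choice (which is a family indexed by a finite set, not a list). The premises on bound variables
  exclude capture.
\<close>

inductive scong :: "('x, 's, 'a, 'c) proc \<Rightarrow> ('x, 's, 'a, 'c) proc \<Rightarrow> bool"  (infix "\<equiv>\<^sub>p" 50)
where
  refl: "P \<equiv>\<^sub>p P"
| sym: "P \<equiv>\<^sub>p Q \<Longrightarrow> Q \<equiv>\<^sub>p P"
| trans: "P \<equiv>\<^sub>p Q \<Longrightarrow> Q \<equiv>\<^sub>p R \<Longrightarrow> P \<equiv>\<^sub>p R"

| par_unit: "Par P Stop \<equiv>\<^sub>p P"
| par_comm: "Par P Q \<equiv>\<^sub>p Par Q P"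
| par_assoc: "Par (Par P Q) R \<equiv>\<^sub>p Par P (Par Q R)"

| unfold: "fv P \<inter> bv P = {} \<Longrightarrow> fpv (Fix X P) \<inter> bpv P = {} \<Longrightarrow>
    Fix X P \<equiv>\<^sub>p psubst X (Fix X P) P"
| cond: "Cond b (map Val vs) P Q \<equiv>\<^sub>p (if b vs then P else Q)"

| res_stop: "Res Stop c \<equiv>\<^sub>p Stop"
| res_comm: "Res (Res P c) d \<equiv>\<^sub>p Res (Res P d) c"
| res_par: "c \<notin> fchans Q \<Longrightarrow> Res (Par P Q) c \<equiv>\<^sub>p Par (Res P c) Q"

| alpha_rcv: "(\<forall>(P, p)\<in>set C. y \<notin> fv P \<union> bv P) \<Longrightarrow>
    Timeout (Rcv c x) C D \<equiv>\<^sub>p Timeout (Rcv c y) (map (\<lambda>(P, p). (subst x (Var y) P, p)) C) D"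
| alpha_read: "(\<forall>(P, p)\<in>set C. y \<notin> fv P \<union> bv P) \<Longrightarrow>
    Phy (Read s x) C \<equiv>\<^sub>p Phy (Read s y) (map (\<lambda>(P, p). (subst x (Var y) P, p)) C)"
| alpha_fix: "Y \<notin> fpv P \<union> bpv P \<Longrightarrow> Fix X P \<equiv>\<^sub>p Fix Y (psubst X (PVar Y) P)"

| perm_tick: "mset C = mset C' \<Longrightarrow> Tick C \<equiv>\<^sub>p Tick C'"
| perm_timeout: "mset C = mset C' \<Longrightarrow> mset D = mset D' \<Longrightarrow> Timeout ch C D \<equiv>\<^sub>p Timeout ch C' D'"
| perm_phy: "mset C = mset C' \<Longrightarrow> Phy ph C \<equiv>\<^sub>p Phy ph C'"

| cong_tick: "P \<equiv>\<^sub>p Q \<Longrightarrow> Tick (C1 @ (P, p) # C2) \<equiv>\<^sub>p Tick (C1 @ (Q, p) # C2)"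
| cong_par: "P \<equiv>\<^sub>p P' \<Longrightarrow> Q \<equiv>\<^sub>p Q' \<Longrightarrow> Par P Q \<equiv>\<^sub>p Par P' Q'"
| cong_timeout1: "P \<equiv>\<^sub>p Q \<Longrightarrow>
    Timeout ch (C1 @ (P, p) # C2) D \<equiv>\<^sub>p Timeout ch (C1 @ (Q, p) # C2) D"
| cong_timeout2: "P \<equiv>\<^sub>p Q \<Longrightarrow>
    Timeout ch C (D1 @ (P, p) # D2) \<equiv>\<^sub>p Timeout ch C (D1 @ (Q, p) # D2)"
| cong_phy: "P \<equiv>\<^sub>p Q \<Longrightarrow> Phy ph (C1 @ (P, p) # C2) \<equiv>\<^sub>p Phy ph (C1 @ (Q, p) # C2)"
| cong_cond: "P \<equiv>\<^sub>p P' \<Longrightarrow> Q \<equiv>\<^sub>p Q' \<Longrightarrow> Cond b es P Q \<equiv>\<^sub>p Cond b es P' Q'"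
| cong_res: "P \<equiv>\<^sub>p Q \<Longrightarrow> Res P c \<equiv>\<^sub>p Res Q c"
| cong_fix: "P \<equiv>\<^sub>p Q \<Longrightarrow> Fix X P \<equiv>\<^sub>p Fix X Q"

inductive cps_cong :: "('x, 's, 'a, 'c) cps \<Rightarrow> ('x, 's, 'a, 'c) cps \<Rightarrow> bool"  (infix "\<equiv>\<^sub>c" 50)
where
  CPS: "P \<equiv>\<^sub>p Q \<Longrightarrow> CPS E S P \<equiv>\<^sub>c CPS E S Q"
| Dead: "Dead \<equiv>\<^sub>c Dead"

definition dist_cong :: "('x, 's, 'a, 'c) cps pmf \<Rightarrow> ('x, 's, 'a, 'c) cps pmf \<Rightarrow> bool"
    (infix "\<equiv>\<^sub>d" 50)
where
  "\<gamma> \<equiv>\<^sub>d \<gamma>' \<longleftrightarrow>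
    (\<forall>M. measure_pmf.prob \<gamma> {N. M \<equiv>\<^sub>c N} = measure_pmf.prob \<gamma>' {N. M \<equiv>\<^sub>c N})"

end

theory Submission
  imports Defs
begin

text \<open>
  The rank of a process bounds the number of actions it can perform before the next \<open>tick\<close>. It
  ignores everything behind a \<open>tick\<close>, so unfolding a time-guarded recursion does not increase it,
  and every untimed transition lowers it. This yields well-timedness, and patience
  follows by induction on the rank. Ticks are deterministic up to equality, not just up to
  structural congruence.
\<close>

fun proc_rank :: "('x, 's, 'a, 'c) proc \<Rightarrow> nat" where
  "proc_rank Stop = 0"
| "proc_rank (Tick C) = 0"
| "proc_rank (Par P Q) = Suc (proc_rank P + proc_rank Q)"
| "proc_rank (Timeout ch C D) = Suc (\<Sum>(P, p)\<leftarrow>C. proc_rank P)"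
| "proc_rank (Phy ph C) = Suc (\<Sum>(P, p)\<leftarrow>C. proc_rank P)"
| "proc_rank (Cond b es P Q) = Suc (proc_rank P + proc_rank Q)"
| "proc_rank (Res P c) = Suc (proc_rank P)"
| "proc_rank (PVar X) = 0"
| "proc_rank (Fix X P) = Suc (proc_rank P)"

text \<open>
  Unlike \<open>wf_proc\<close>, this is preserved by the reception of a non-real value that is later
  written to an actuator.
\<close>

fun guarded_proc :: "('x, 's, 'a, 'c) proc \<Rightarrow> bool" where
  "guarded_proc Stop \<longleftrightarrow> True"
| "guarded_proc (Tick C) \<longleftrightarrow> wf_weights C \<and> (\<forall>(P, p)\<in>set C. guarded_proc P)"
| "guarded_proc (Par P Q) \<longleftrightarrow> guarded_proc P \<and> guarded_proc Q"
| "guarded_proc (Timeout ch C D) \<longleftrightarrow>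
     wf_weights C \<and> (\<forall>(P, p)\<in>set C. guarded_proc P) \<and>
     wf_weights D \<and> (\<forall>(P, p)\<in>set D. guarded_proc P)"
| "guarded_proc (Phy ph C) \<longleftrightarrow> wf_weights C \<and> (\<forall>(P, p)\<in>set C. guarded_proc P)"
| "guarded_proc (Cond b es P Q) \<longleftrightarrow> guarded_proc P \<and> guarded_proc Q"
| "guarded_proc (Res P c) \<longleftrightarrow> guarded_proc P"
| "guarded_proc (PVar X) \<longleftrightarrow> True"
| "guarded_proc (Fix X P) \<longleftrightarrow> time_guarded X P \<and> guarded_proc P"

lemma guarded_proc_if_wf_proc: "wf_proc P \<Longrightarrow> guarded_proc P"
  by (induction P rule: guarded_proc.induct) auto

lemma wf_weights_map:
  assumes "wf_weights C"
  shows "wf_weights (map (\<lambda>(P, p). (f P, p)) C)"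
  using assms by (force simp: wf_weights_def comp_def case_prod_beta')

text \<open>\<open>pmf_of_list\<close> is characterised only for weight lists that are nonnegative
  and sum to 1; \<open>wf_weights\<close> is therefore carried along in
  \<open>guarded_proc\<close>.\<close>

lemma set_choice_dist:
  assumes "wf_weights C"
  shows "set_pmf (choice_dist C) \<subseteq> fst ` set C"
proof -
  have "pmf_of_list_wf C"
    using assms by (force simp: wf_weights_def pmf_of_list_wf_def case_prod_beta')
  then show ?thesis
    unfolding choice_dist_def using set_pmf_of_list by force
qed

lemma time_guarded_if_not_free: "X \<notin> fpv P \<Longrightarrow> time_guarded X P"
  by (induction X P rule: time_guarded.induct) auto

subsection \<open>Substitution of values\<close>

lemma fpv_subst [simp]: "fpv (subst z u P) = fpv P"
  by (induction z u P rule: subst.induct) (auto; force)+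

lemma time_guarded_subst [simp]: "time_guarded X (subst z u P) = time_guarded X P"
  by (induction z u P rule: subst.induct) (auto; force)+

lemma guarded_proc_subst: "guarded_proc P \<Longrightarrow> guarded_proc (subst z u P)"
  by (induction z u P rule: subst.induct) (auto intro!: wf_weights_map)

lemma rank_subst [simp]: "proc_rank (subst z u P) = proc_rank P"
  by (induction z u P rule: subst.induct)
    (auto simp: comp_def case_prod_beta' intro!: arg_cong[of _ _ sum_list])

subsection \<open>Unfolding of recursion\<close>

lemma fv_psubst: "fv (psubst X R P) \<subseteq> fv P \<union> fv R"
  by (induction X R P rule: psubst.induct) (auto; fastforce)+

lemma fpv_psubst: "fpv (psubst X R P) \<subseteq> (fpv P - {X}) \<union> fpv R"
  by (induction X R P rule: psubst.induct) (auto; fastforce)+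

text \<open>New occurrences of \<open>Y\<close> could only come from \<open>R\<close>, and a process
  without free process variables guards every variable.\<close>

lemma time_guarded_psubst:
  "time_guarded Y P \<Longrightarrow> fpv R = {} \<Longrightarrow> time_guarded Y (psubst X R P)"
  by (induction X R P rule: psubst.induct) (auto simp: time_guarded_if_not_free)

lemma guarded_proc_psubst:
  "guarded_proc P \<Longrightarrow> guarded_proc R \<Longrightarrow> fpv R = {} \<Longrightarrow> guarded_proc (psubst X R P)"
  by (induction X R P rule: psubst.induct) (auto intro!: wf_weights_map time_guarded_psubst)

lemma wf_proc_psubst:
  "wf_proc P \<Longrightarrow> wf_proc R \<Longrightarrow> fpv R = {} \<Longrightarrow> wf_proc (psubst X R P)"
  by (induction X R P rule: psubst.induct) (auto intro!: wf_weights_map time_guarded_psubst)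

text \<open>All free occurrences of \<open>X\<close> lie in parts behind a \<open>tick\<close>,
  which the rank does not inspect, so the rank of \<open>R\<close> never enters.\<close>

lemma rank_psubst: "time_guarded X P \<Longrightarrow> proc_rank (psubst X R P) = proc_rank P"
  by (induction X R P rule: psubst.induct)
    (auto simp: comp_def case_prod_beta' intro!: arg_cong[of _ _ sum_list]; force)+

subsection \<open>Transitions\<close>

text \<open>The bound is the rank of a prefix with continuation \<open>C\<close>: its
  \<open>Suc\<close> pays for the prefix, and the sum dominates each alternative.\<close>

lemma choice_dist_properties:
  assumes "wf_weights C" "\<forall>(P, p)\<in>set C. guarded_proc P" "(\<Union>(P, p)\<in>set C. fpv P) = {}"
    and "Q \<in> set_pmf (choice_dist C)"
  shows "guarded_proc Q \<and> fpv Q = {} \<and> proc_rank Q < Suc (\<Sum>(P, p)\<leftarrow>C. proc_rank P)"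
proof -
  obtain p where "(Q, p) \<in> set C"
    using assms(4) set_choice_dist[OF assms(1)] by force
  moreover from this have "proc_rank Q \<le> (\<Sum>(P, p)\<leftarrow>C. proc_rank P)"
    by (force intro!: member_le_sum_list)
  ultimately show ?thesis
    using assms(2,3) by auto
qed

text \<open>Since \<open>Par\<close> adds ranks, a move of either side or of both lowers the total.
  Closedness is tracked for process variables only, because a read leaves its bound variable free in
  the successor until the sensor value is substituted.\<close>

lemma untimed_decreases_rank:
  assumes "untimed P l \<pi>" "guarded_proc P" "fpv P = {}" "Q \<in> set_pmf \<pi>"
  shows "guarded_proc Q \<and> fpv Q = {} \<and> proc_rank Q < proc_rank P"
  using assms
proof (induction arbitrary: Q rule: untimed.induct)
  case (Out c v C D)
  then show ?case using choice_dist_properties[of C Q] by simp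
next
  case (Inp c x C D v)
  then obtain R where "R \<in> set_pmf (choice_dist C)" "Q = subst x (Val v) R"
    by auto
  with Inp.prems(1,2) show ?case
    using choice_dist_properties[of C R] by (simp add: guarded_proc_subst)
next
  case (Write a v C)
  then show ?case using choice_dist_properties[of C Q] by simp
next
  case (Read s x C)
  then show ?case using choice_dist_properties[of C Q] by simp
next
  case (Com1 P c v \<pi>1 P' \<pi>2)
  obtain R R' where R: "Q = Par R R'" "R \<in> set_pmf \<pi>1" "R' \<in> set_pmf \<pi>2"
    using Com1.prems(3) by (auto simp: par_dist_def)
  show ?case
    using Com1.IH(1)[OF _ _ R(2)] Com1.IH(2)[OF _ _ R(3)] Com1.prems(1,2) R(1) by simp
next
  case (Com2 P c v \<pi>1 P' \<pi>2)
  obtain R R' where R: "Q = Par R R'" "R \<in> set_pmf \<pi>1" "R' \<in> set_pmf \<pi>2"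
    using Com2.prems(3) by (auto simp: par_dist_def)
  show ?case
    using Com2.IH(1)[OF _ _ R(2)] Com2.IH(2)[OF _ _ R(3)] Com2.prems(1,2) R(1) by simp
next
  case (Par1 P l \<pi> P')
  obtain R where R: "Q = Par R P'" "R \<in> set_pmf \<pi>"
    using Par1.prems(3) by (auto simp: par_dist_def)
  show ?case
    using Par1.IH[OF _ _ R(2)] Par1.prems(1,2) R(1) by simp
next
  case (Par2 P l \<pi> P')
  obtain R where R: "Q = Par P' R" "R \<in> set_pmf \<pi>"
    using Par2.prems(3) by (auto simp: par_dist_def)
  show ?case
    using Par2.IH[OF _ _ R(2)] Par2.prems(1,2) R(1) by simp
next
  case (Res P l \<pi> c)
  obtain R where R: "Q = Res R c" "R \<in> set_pmf \<pi>"
    using Res.prems(3) by auto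
  show ?case
    using Res.IH[OF _ _ R(2)] Res.prems(1,2) R(1) by simp
next
  case (Cond es vs b P P' l \<pi>)
  show ?case
    using Cond.IH[OF _ _ Cond.prems(3)] Cond.prems(1,2) by (cases "b vs") auto
next
  case (Fix X P l \<pi>)
  \<comment> \<open>The induction hypothesis speaks of the unfolding, whose rank is that of the body
    and hence one less than that of \<open>Fix X P\<close>.\<close>
  have "guarded_proc (psubst X (Fix X P) P)"
    using Fix.prems by (intro guarded_proc_psubst) auto
  moreover have "fpv (psubst X (Fix X P) P) = {}"
    using Fix.prems fpv_psubst[of X "Fix X P" P] by auto
  ultimately show ?case
    using Fix.IH[OF _ _ Fix.prems(3)] Fix.prems(1) by (simp add: rank_psubst)
qed

section \<open>Determinism of the passage of time\<close>

lemma untimed_not_tick: "untimed P l \<pi> \<Longrightarrow> l \<noteq> TickL"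
  by (induction rule: untimed.induct) auto

lemma proc_trans_untimed_iff: "l \<noteq> TickL \<Longrightarrow> proc_trans P l \<pi> \<longleftrightarrow> untimed P l \<pi>"
  by (auto elim: proc_trans.cases intro: proc_trans.Untimed)

text \<open>Makes the data of a decided guard unique, so two derivations for a conditional select
  the same branch.\<close>

lemma map_Val_eq_iff: "map Val vs = map Val vs' \<longleftrightarrow> vs = vs'"
  by (simp add: inj_map_eq_map inj_def)

text \<open>Each process constructor has at most one rule yielding \<open>TickL\<close>, and its
  premises determine the result by induction. The label is a variable constrained by an equation to
  suit the rule induction.\<close>

lemma proc_tick_deterministic:
  assumes "proc_trans P l \<pi>" "proc_trans P l \<pi>'" "l = TickL"
  shows "\<pi> = \<pi>'"
  using assms
proof (induction arbitrary: \<pi>' rule: proc_trans.induct)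
  case (Untimed P l \<pi>)
  then show ?case using untimed_not_tick by blast
next
  case TimeNil
  then show ?case by (auto elim: proc_trans.cases dest: untimed_not_tick)
next
  case (Delay C)
  then show ?case by (auto elim: proc_trans.cases dest: untimed_not_tick)
next
  case (TimeoutTick ch C D)
  then show ?case by (auto elim: proc_trans.cases dest: untimed_not_tick)
next
  case (ParTick P \<pi>1 Q \<pi>2)
  from ParTick.prems(1) ParTick.IH show ?case
    by (cases rule: proc_trans.cases) (auto dest: untimed_not_tick)
next
  case (ResTick P \<pi> c)
  from ResTick.prems(1) ResTick.IH show ?case
    by (cases rule: proc_trans.cases) (auto dest: untimed_not_tick)
next
  case (CondTick es vs b P Q \<pi>)
  from CondTick.prems(1) CondTick.IH CondTick.hyps(1) show ?case
    by (cases rule: proc_trans.cases) (auto simp: map_Val_eq_iff dest: untimed_not_tick)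
next
  case (FixTick X P \<pi>)
  from FixTick.prems(1) FixTick.IH show ?case
    by (cases rule: proc_trans.cases) (auto dest: untimed_not_tick)
qed

section \<open>Patience of processes\<close>

lemma closed_exps_values: "(\<Union>e\<in>set es. exp_vars e) = {} \<Longrightarrow> \<exists>vs. es = map Val vs"
proof (induction es)
  case (Cons e es)
  then obtain vs where "es = map Val vs" by auto
  moreover obtain v where "e = Val v"
    using Cons.prems by (cases e) auto
  ultimately have "e # es = map Val (v # vs)" by simp
  then show ?case by (rule exI)
qed simp

text \<open>The excluded transitions are those that a system satisfying its invariant turns into
  \<open>TauL\<close>. Pending inputs and outputs never block time, since a \<open>Timeout\<close>
  can always tick. The induction is on rank because an unfolding is not a subterm.\<close>

lemma proc_patience:
  assumes "wf_proc P" "fv P = {}" "fpv P = {}"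
    and "\<And>\<pi>. \<not> untimed P TauL \<pi>" "\<And>s z \<pi>. \<not> untimed P (ReadL s z) \<pi>"
    and "\<And>a r \<pi>. \<not> untimed P (WriteL a (RealV r)) \<pi>"
  shows "\<exists>\<pi>. proc_trans P TickL \<pi>"
  using assms
proof (induction "proc_rank P" arbitrary: P rule: less_induct)
  case less
  show ?case
  proof (cases P)
    case (Par P1 P2)
    have "\<exists>\<pi>. proc_trans P1 TickL \<pi>"
      using less.prems Par by (intro less.hyps) (auto, (metis untimed.Par1)+)
    moreover have "\<exists>\<pi>. proc_trans P2 TickL \<pi>"
      using less.prems Par by (intro less.hyps) (auto, (metis untimed.Par2)+)
    \<comment> \<open>A synchronisation between the two sides is excluded by the assumption on the
      whole composition, which is the negative premise of \<open>ParTick\<close>.\<close>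
    ultimately show ?thesis
      using less.prems(4) Par by (blast intro: proc_trans.ParTick)
  next
    case (Phy ph C)
    show ?thesis
    proof (cases ph)
      case (Read s x)
      with less.prems(5) Phy show ?thesis by (blast intro: untimed.Read)
    next
      case (Write a e)
      \<comment> \<open>Closedness excludes a variable and \<open>wf_proc\<close> a non-real value,
        so the write would be enabled, a contradiction.\<close>
      with less.prems(1,2) Phy obtain r where "e = Val (RealV r)"
        by (cases e) auto
      with less.prems(6) Phy Write show ?thesis by (blast intro: untimed.Write)
    qed
  next
    case (Cond b es P1 P2)
    then obtain vs where vs: "es = map Val vs"
      using less.prems(2) closed_exps_values[of es] by auto
    have "\<exists>\<pi>. proc_trans (if b vs then P1 else P2) TickL \<pi>"
      using less.prems Cond untimed.Cond[OF vs, of b P1 P2]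
      by (intro less.hyps) (auto, metis+)
    then show ?thesis
      using Cond proc_trans.CondTick[OF vs] by blast
  next
    case (Res P1 c)
    \<comment> \<open>Restriction blocks only inputs and outputs, so any of the excluded transitions
      of \<open>P1\<close> would lift to \<open>P\<close>.\<close>
    have "\<exists>\<pi>. proc_trans P1 TickL \<pi>"
      using less.prems Res by (intro less.hyps) (auto dest: untimed.Res[where c = c])
    then show ?thesis
      using Res by (blast intro: proc_trans.ResTick)
  next
    case (Fix X P1)
    have "\<exists>\<pi>. proc_trans (psubst X P P1) TickL \<pi>"
    proof (rule less.hyps)
      show "proc_rank (psubst X P P1) < proc_rank P"
        using less.prems(1) Fix by (simp add: rank_psubst)
      show "wf_proc (psubst X P P1)"
        using less.prems Fix by (intro wf_proc_psubst) auto
      show "fv (psubst X P P1) = {}" "fpv (psubst X P P1) = {}"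
        using less.prems(2,3) Fix fv_psubst[of X P P1] fpv_psubst[of X P P1] by auto
    qed (use less.prems(4-6) Fix untimed.Fix in blast)+
    then show ?thesis
      using Fix by (blast intro: proc_trans.FixTick)
  \<comment> \<open>\<open>Stop\<close>, \<open>Tick\<close> and \<open>Timeout\<close> tick by
    axioms; \<open>PVar\<close> contradicts closedness.\<close>
  qed (use less.prems in \<open>auto intro: proc_trans.intros\<close>)
qed

section \<open>Lifting to cyber-physical systems\<close>

text \<open>The additional one pays for the step into \<open>Dead\<close>, which is possible even
  when the process has rank 0.\<close>

fun cps_rank :: "('x, 's, 'a, 'c) cps \<Rightarrow> nat" where
  "cps_rank (CPS E S P) = Suc (proc_rank P)"
| "cps_rank Dead = 0"

fun guarded_cps :: "('x, 's, 'a, 'c) cps \<Rightarrow> bool" where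
  "guarded_cps (CPS E S P) \<longleftrightarrow> guarded_proc P \<and> fpv P = {}"
| "guarded_cps Dead \<longleftrightarrow> True"

lemma cps_trans_untimed_iff: "l \<noteq> TickL \<Longrightarrow> cps_trans M l \<gamma> \<longleftrightarrow> cps_untimed M l \<gamma>"
  by (auto elim: cps_trans.cases intro: cps_trans.Untimed)

text \<open>No rule of \<open>cps_untimed\<close> yields \<open>TickL\<close>, so every tick stems
  from the rule \<open>Time\<close>; time determinism, maximal progress and patience are all read
  off from its premises.\<close>

lemma cps_tick_iff:
  "cps_trans (CPS E S P) TickL \<gamma> \<longleftrightarrow>
    (\<exists>\<pi>. proc_trans P TickL \<pi> \<and> \<gamma> = cps_dist E (next_state E S) \<pi>) \<and>
    \<not> (\<exists>\<gamma>. cps_untimed (CPS E S P) TauL \<gamma>) \<and> sat_inv E S"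
  by (auto elim!: cps_trans.cases elim: cps_untimed.cases intro: cps_trans.Time)

text \<open>Substituting the sensor value after a read preserves the rank, and
  \<open>cps_rank\<close> does not depend on the physical state changed by a write.\<close>

lemma cps_untimed_decreases_rank:
  assumes "cps_untimed M l \<gamma>" "guarded_cps M" "N \<in> set_pmf \<gamma>"
  shows "guarded_cps N \<and> cps_rank N < cps_rank M"
  using assms
  by (cases rule: cps_untimed.cases)
    (auto simp: cps_dist_def proc_trans_untimed_iff guarded_proc_subst
      dest: untimed_decreases_rank)

lemma untimed_trace_length:
  assumes "cps_trace M ls N" "guarded_cps M" "\<forall>l\<in>set ls. l \<noteq> TickL"
  shows "length ls \<le> cps_rank M"
  using assms
proof (induction rule: cps_trace.induct)
  case (Step M l \<gamma> M' ls N)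
  then have "guarded_cps M'" "cps_rank M' < cps_rank M"
    using cps_untimed_decreases_rank[of M l \<gamma> M'] by (auto simp: cps_trans_untimed_iff)
  with Step show ?case by simp
qed simp

theorem theorem1:
  fixes E :: "('x, 's, 'a) env" and S :: "('x, 's, 'a) state" and P :: "('x, 's, 'a, 'c) proc"
    and M :: "('x, 's, 'a, 'c) cps"
  assumes "M = CPS E S P" and "wf_cps M"
  shows
    "(\<forall>\<gamma> \<gamma>'. cps_trans M TickL \<gamma> \<and> cps_trans M TickL \<gamma>' \<longrightarrow> \<gamma> \<equiv>\<^sub>d \<gamma>') \<and>
     (\<forall>\<gamma>. cps_trans M TauL \<gamma> \<longrightarrow> \<not> (\<exists>\<gamma>'. cps_trans M TickL \<gamma>')) \<and>
     (\<not> (\<exists>\<gamma>. cps_trans M TickL \<gamma>) \<longrightarrow> \<not> sat_inv E S \<or> (\<exists>\<gamma>'. cps_trans M TauL \<gamma>')) \<and>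
     (\<exists>k::nat. \<forall>\<alpha>s N. cps_trace M \<alpha>s N \<and> (\<forall>\<alpha>\<in>set \<alpha>s. \<alpha> \<noteq> TickL) \<longrightarrow> length \<alpha>s \<le> k)"
proof (intro conjI)
  have wf: "wf_proc P" "fv P = {}" "fpv P = {}"
    using assms by (auto simp: closed_proc_def)
  show "\<forall>\<gamma> \<gamma>'. cps_trans M TickL \<gamma> \<and> cps_trans M TickL \<gamma>' \<longrightarrow> \<gamma> \<equiv>\<^sub>d \<gamma>'"
    \<comment> \<open>The process parts coincide and \<open>next_state E S\<close> is fixed by the
      state, so the two distributions are even equal.\<close>
    using proc_tick_deterministic unfolding assms(1) cps_tick_iff dist_cong_def by blast
  show "\<forall>\<gamma>. cps_trans M TauL \<gamma> \<longrightarrow> \<not> (\<exists>\<gamma>'. cps_trans M TickL \<gamma>')"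
    unfolding assms(1) cps_tick_iff by (auto simp: cps_trans_untimed_iff)
  show "\<not> (\<exists>\<gamma>. cps_trans M TickL \<gamma>) \<longrightarrow> \<not> sat_inv E S \<or> (\<exists>\<gamma>'. cps_trans M TauL \<gamma>')"
  proof (rule impI, rule ccontr)
    assume stuck: "\<not> (\<exists>\<gamma>. cps_trans M TickL \<gamma>)"
      and "\<not> (\<not> sat_inv E S \<or> (\<exists>\<gamma>'. cps_trans M TauL \<gamma>'))"
    then have inv: "sat_inv E S" and no_tau: "\<And>\<gamma>. \<not> cps_untimed (CPS E S P) TauL \<gamma>"
      by (auto simp: assms(1) cps_trans_untimed_iff)
    have "\<exists>\<pi>. proc_trans P TickL \<pi>"
      using wf
    proof (rule proc_patience)
      \<comment> \<open>Under the invariant, each kind of process transition to be excluded would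
        give a \<open>TauL\<close> step of the system, by \<open>Tau\<close>,
        \<open>SensRead\<close> or \<open>ActWrite\<close>.\<close>
      show "\<not> untimed P TauL \<pi>" for \<pi>
        using no_tau cps_untimed.Tau[OF proc_trans.Untimed inv] by blast
      show "\<not> untimed P (ReadL s z) \<pi>" for s z \<pi>
        using no_tau cps_untimed.SensRead[OF proc_trans.Untimed inv] by blast
      show "\<not> untimed P (WriteL a (RealV r)) \<pi>" for a r \<pi>
        using no_tau cps_untimed.ActWrite[OF proc_trans.Untimed inv] by blast
    qed
    with stuck inv no_tau show False
      unfolding assms(1) cps_tick_iff by blast
  qed
  \<comment> \<open>The bound \<open>k\<close> is \<open>cps_rank M\<close>, which depends on
    \<open>M\<close> alone and not on the trace.\<close>
  have "guarded_cps M"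
    using wf by (simp add: assms(1) guarded_proc_if_wf_proc)
  then show "\<exists>k::nat. \<forall>\<alpha>s N. cps_trace M \<alpha>s N \<and> (\<forall>\<alpha>\<in>set \<alpha>s. \<alpha> \<noteq> TickL) \<longrightarrow> length \<alpha>s \<le> k"
    using untimed_trace_length by blast
qed

end
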